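(* There is an absolute constant $C>0$ such that for every $A>0$ there exist $N\in\mathbb N$, a weight $w:T_N^2\to\{0,1\}$ and a (finite, nonnegative) measure $\mu$ on $\partial T^2_N$ such that $$[w,\mu]_{HC}\le C\qquad\text{but}\qquad[w,\mu]_{CE}\ge A.$$ That is, the restricted energy (hereditary Carleson) condition does not imply the Carleson embedding for general weights.
   Context: $T^2_N$ is the set of all dyadic rectangles contained in $[0,1]^2$ (products of two dyadic intervals) with both side lengths at least $2^{-N}$, ordered by inclusion. $\partial T^2_N$ is the set of its minimal elements, i.e. the dyadic squares of size $2^{-N}\times2^{-N}$. A measure on $\partial T_N^2$ is a function $\mu:\partial T_N^2\to[0,\infty)$, extended by $0$ to all of $T_N^2$. For $\psi:T_N^2\to\mathbb R$ put $\mathbb I^*\psi(\gamma)=\sum_{\gamma'\le\gamma}\psi(\gamma')$, and $\mu(E)=\sum_{\omega\in E}\mu(\omega)$ for $E\subset T_N^2$. $[w,\mu]_{HC}$ is the smallest constant such that $\sum_{\alpha\in T_N^2}w(\alpha)(\mathbb I^*(\mu\mathbf 1_E)(\alpha))^2\le[w,\mu]_{HC}\,\mu(E)$ for all $E\subset T_N^2$. $[w,\mu]_{CE}$ is the smallest constant such that $\sum_{\alpha\in T_N^2}w(\alpha)|\mathbb I^*(\psi\mu)(\alpha)|^2\le[w,\mu]_{CE}\sum_{\omega\in T_N^2}|\psi(\omega)|^2\mu(\omega)$ for all functions $\psi:T_N^2\to\mathbb R$. *)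

theory Defs
  imports "HOL-Analysis.Analysis"
begin

type_synonym rectangle = "(real \<times> real) set"

definition dyadic_interval :: "int \<Rightarrow> int \<Rightarrow> real set" where
  "dyadic_interval k j = {of_int j * 2 powi (- k) ..< (of_int j + 1) * 2 powi (- k)}"

definition bitree :: "nat \<Rightarrow> rectangle set" where
  "bitree N = {dyadic_interval k i \<times> dyadic_interval l j | k i l j.
      dyadic_interval k i \<times> dyadic_interval l j \<subseteq> {0..1} \<times> {0..1} \<and>
      (2::real) powi (- int N) \<le> 2 powi (- k) \<and> (2::real) powi (- int N) \<le> 2 powi (- l)}"

definition bdry :: "nat \<Rightarrow> rectangle set" where
  "bdry N = {\<omega> \<in> bitree N. \<forall>\<gamma> \<in> bitree N. \<gamma> \<subseteq> \<omega> \<longrightarrow> \<gamma> = \<omega>}"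

definition bdry_measure :: "nat \<Rightarrow> (rectangle \<Rightarrow> real) \<Rightarrow> bool" where
  "bdry_measure N \<mu> \<longleftrightarrow> (\<forall>\<omega> \<in> bdry N. 0 \<le> \<mu> \<omega>) \<and> (\<forall>\<gamma> \<in> bitree N - bdry N. \<mu> \<gamma> = 0)"

definition Istar :: "nat \<Rightarrow> (rectangle \<Rightarrow> real) \<Rightarrow> rectangle \<Rightarrow> real" where
  "Istar N \<psi> \<gamma> = (\<Sum>\<gamma>' \<in> {\<gamma>' \<in> bitree N. \<gamma>' \<subseteq> \<gamma>}. \<psi> \<gamma>')"

definition HC_bound :: "nat \<Rightarrow> (rectangle \<Rightarrow> real) \<Rightarrow> (rectangle \<Rightarrow> real) \<Rightarrow> real \<Rightarrow> bool" where
  "HC_bound N w \<mu> c \<longleftrightarrow> (\<forall>E \<subseteq> bitree N.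
      (\<Sum>\<alpha> \<in> bitree N. w \<alpha> * (Istar N (\<lambda>\<gamma>. \<mu> \<gamma> * indicator E \<gamma>) \<alpha>)\<^sup>2) \<le> c * (\<Sum>\<omega> \<in> E. \<mu> \<omega>))"

definition CE_bound :: "nat \<Rightarrow> (rectangle \<Rightarrow> real) \<Rightarrow> (rectangle \<Rightarrow> real) \<Rightarrow> real \<Rightarrow> bool" where
  "CE_bound N w \<mu> c \<longleftrightarrow> (\<forall>\<psi> :: rectangle \<Rightarrow> real.
      (\<Sum>\<alpha> \<in> bitree N. w \<alpha> * \<bar>Istar N (\<lambda>\<gamma>. \<psi> \<gamma> * \<mu> \<gamma>) \<alpha>\<bar>\<^sup>2)
        \<le> c * (\<Sum>\<omega> \<in> bitree N. \<bar>\<psi> \<omega>\<bar>\<^sup>2 * \<mu> \<omega>))"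

(* The condition 0 \<le> c only matters for \<mu> = 0, where every real c is admissible and the
   smallest constant is taken to be 0. The infima are attained: see HC_const_least and
   CE_const_least below. *)
definition HC_const :: "nat \<Rightarrow> (rectangle \<Rightarrow> real) \<Rightarrow> (rectangle \<Rightarrow> real) \<Rightarrow> real" where
  "HC_const N w \<mu> = Inf {c. 0 \<le> c \<and> HC_bound N w \<mu> c}"

definition CE_const :: "nat \<Rightarrow> (rectangle \<Rightarrow> real) \<Rightarrow> (rectangle \<Rightarrow> real) \<Rightarrow> real" where
  "CE_const N w \<mu> = Inf {c. 0 \<le> c \<and> CE_bound N w \<mu> c}"

lemma dyadic_interval_subset_unit:
  assumes "dyadic_interval k j \<subseteq> {0..1}"
  shows "0 \<le> k" "0 \<le> j" "j < 2 ^ nat k"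
proof -
  define d :: real where "d = 2 powi (- k)"
  have d: "d > 0" by (simp add: d_def)
  have sub: "{of_int j * d ..< (of_int j + 1) * d} \<subseteq> {0..1}"
    using assms by (simp add: dyadic_interval_def d_def)
  have lt: "of_int j * d < (of_int j + 1) * d" using d by (simp add: algebra_simps)
  have 1: "0 \<le> of_int j * d" and 2: "(of_int j + 1) * d \<le> 1"
  proof -
    show "0 \<le> of_int j * d" using sub lt by (auto simp: subset_iff)
    show "(of_int j + 1) * d \<le> 1"
    proof (rule dense_le_bounded[OF lt])
      fix x assume "of_int j * d < x" "x < (of_int j + 1) * d"
      then show "x \<le> 1" using sub by (auto simp: subset_iff)
    qed
  qed
  show j: "0 \<le> j" using 1 d by (simp add: zero_le_mult_iff)
  have "1 * d \<le> (of_int j + 1) * d" using j d by (intro mult_right_mono) auto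
  then have d1: "d \<le> 1" using 2 by simp
  show k: "0 \<le> k"
  proof (rule ccontr)
    assume "\<not> 0 \<le> k"
    then have "d = 2 ^ nat (- k)" "nat (-k) \<noteq> 0" by (simp_all add: d_def power_int_def)
    then have "d > 1" by (simp only: one_less_power[of "2::real"])
    with d1 show False by simp
  qed
  have "d = 1 / 2 ^ nat k" using k by (cases "k = 0") (auto simp: d_def power_int_def field_simps)
  then have "of_int j + 1 \<le> (2::real) ^ nat k"
    using 2 by (simp only: mult_1_right times_divide_eq_right) (simp add: divide_le_eq)
  then have "of_int (j + 1) \<le> (of_int (2 ^ nat k) :: real)" by simp
  then show "j < 2 ^ nat k" by (simp only: of_int_le_iff)
qed

lemma dyadic_interval_ne: "dyadic_interval k j \<noteq> {}"
proof -
  have "of_int j * 2 powi (- k) < (of_int j + 1) * (2::real) powi (- k)"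
    by (intro mult_strict_right_mono) auto
  then show ?thesis by (auto simp: dyadic_interval_def)
qed

lemma powi_scale_le: "(2::real) powi (- int N) \<le> 2 powi (- k) \<longleftrightarrow> k \<le> int N"
  using power_int_increasing[of "- int N" "- k" "2::real"]
    power_int_strict_increasing[of "- k" "- int N" "2::real"] by (cases "k \<le> int N") simp_all

lemma finite_bitree: "finite (bitree N)"
proof (rule finite_subset)
  let ?S = "{0..int N} \<times> {0..<(2::int)^N} \<times> {0..int N} \<times> {0..<(2::int)^N}"
  show "finite ((\<lambda>(k,i,l,j). dyadic_interval k i \<times> dyadic_interval l j) ` ?S)" by simp
  show "bitree N \<subseteq> (\<lambda>(k,i,l,j). dyadic_interval k i \<times> dyadic_interval l j) ` ?S"
  proof
    fix R assume "R \<in> bitree N"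
    then obtain k i l j where R: "R = dyadic_interval k i \<times> dyadic_interval l j"
      and s: "dyadic_interval k i \<times> dyadic_interval l j \<subseteq> {0..1} \<times> {0..1}"
      and b: "k \<le> int N" "l \<le> int N"
      unfolding bitree_def powi_scale_le by blast
    have s1: "dyadic_interval k i \<subseteq> {0..1}" and s2: "dyadic_interval l j \<subseteq> {0..1}"
      using s dyadic_interval_ne[of k i] dyadic_interval_ne[of l j] by (auto simp: times_subset_iff)
    note q1 = dyadic_interval_subset_unit[OF s1] and q2 = dyadic_interval_subset_unit[OF s2]
    have "(2::int) ^ nat k \<le> 2 ^ N" "(2::int) ^ nat l \<le> 2 ^ N"
      using b by (auto intro!: power_increasing)
    then have "i < 2 ^ N" "j < 2 ^ N" using q1(3) q2(3) by linarith+
    then have "(k,i,l,j) \<in> ?S" using q1 q2 b by auto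
    then show "R \<in> (\<lambda>(k,i,l,j). dyadic_interval k i \<times> dyadic_interval l j) ` ?S"
      unfolding R by (intro image_eqI[of _ _ "(k,i,l,j)"]) auto
  qed
qed

lemma dyadic_interval_subset_finer:
  assumes "dyadic_interval k a \<subseteq> dyadic_interval l b" "k \<le> l"
  shows "dyadic_interval k a = dyadic_interval l b"
proof -
  define d e :: real where "d = 2 powi (- k)" and "e = 2 powi (- l)"
  have "e > 0" "e \<le> d" using assms(2) by (auto simp: d_def e_def intro: power_int_increasing)
  have D: "dyadic_interval k a = {of_int a * d ..< of_int a * d + d}"
    and E: "dyadic_interval l b = {of_int b * e ..< of_int b * e + e}"
    by (simp_all add: dyadic_interval_def d_def e_def algebra_simps)
  have "of_int b * e \<le> of_int a * d" "of_int a * d + d \<le> of_int b * e + e"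
    using assms(1) \<open>e > 0\<close> \<open>e \<le> d\<close> unfolding D E by auto
  then show ?thesis using \<open>e \<le> d\<close> unfolding D E by auto
qed

lemma dyadic_interval_refine:
  assumes "k \<le> int N"
  shows "dyadic_interval (int N) (i * 2 ^ nat (int N - k)) \<subseteq> dyadic_interval k i"
proof -
  define e m :: real where "e = 2 powi (- int N)" and "m = 2 ^ nat (int N - k)"
  have m: "m \<ge> 1" and e: "e > 0" by (simp_all add: m_def e_def)
  have "2 powi (- k) = (2::real) powi (int N - k) * 2 powi (- int N)"
    by (subst power_int_add[symmetric]) auto
  then have d: "2 powi (- k) = m * e"
    using assms by (simp add: m_def e_def power_int_def)
  have "e \<le> m * e" using m e by simp
  then have "(of_int i * m + 1) * e \<le> (of_int i + 1) * (m * e)" by (simp add: algebra_simps)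
  then show ?thesis
    unfolding dyadic_interval_def d by (auto simp: e_def[symmetric] m_def[symmetric] mult.assoc)
qed

lemma dyadic_interval_unit:
  assumes "0 \<le> i" "i < 2 ^ N"
  shows "dyadic_interval (int N) i \<subseteq> {0..1}"
proof -
  have e: "(2::real) powi (- int N) = 1 / 2 ^ N" by (simp add: power_int_minus field_simps)
  have "of_int (i + 1) \<le> (of_int (2 ^ N) :: real)" using assms by (simp only: of_int_le_iff)
  then have "(of_int i + 1) * (1 / 2 ^ N) \<le> (1::real)" by simp
  moreover have "0 \<le> of_int i * (1 / 2 ^ N :: real)" using assms by simp
  ultimately show ?thesis
    unfolding dyadic_interval_def e by (intro subsetI) (simp only: atLeastLessThan_iff atLeastAtMost_iff, linarith)
qed

lemma bdry_eq:
  "bdry N = {dyadic_interval (int N) i \<times> dyadic_interval (int N) j | i j.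
     0 \<le> i \<and> i < 2 ^ N \<and> 0 \<le> j \<and> j < 2 ^ N}" (is "_ = ?S")
proof
  show "?S \<subseteq> bdry N"
  proof
    fix \<omega> assume "\<omega> \<in> ?S"
    then obtain i j where \<omega>: "\<omega> = dyadic_interval (int N) i \<times> dyadic_interval (int N) j"
      and ij: "0 \<le> i" "i < 2 ^ N" "0 \<le> j" "j < 2 ^ N" by blast
    have "\<omega> \<subseteq> {0..1} \<times> {0..1}"
      unfolding \<omega> using ij by (intro Sigma_mono dyadic_interval_unit)
    then have "\<omega> \<in> bitree N" unfolding bitree_def \<omega> by blast
    moreover have "\<gamma> = \<omega>" if \<gamma>: "\<gamma> \<in> bitree N" "\<gamma> \<subseteq> \<omega>" for \<gamma>
    proof -
      obtain k a l b where g: "\<gamma> = dyadic_interval k a \<times> dyadic_interval l b"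
        and kl: "k \<le> int N" "l \<le> int N"
        using \<gamma>(1) unfolding bitree_def powi_scale_le by blast
      have "dyadic_interval k a \<subseteq> dyadic_interval (int N) i"
        "dyadic_interval l b \<subseteq> dyadic_interval (int N) j"
        using \<gamma>(2) unfolding g \<omega> times_subset_iff by (auto simp: dyadic_interval_ne)
      then have "dyadic_interval k a = dyadic_interval (int N) i"
        "dyadic_interval l b = dyadic_interval (int N) j"
        using kl dyadic_interval_subset_finer by blast+
      then show ?thesis unfolding g \<omega> by (rule arg_cong2)
    qed
    ultimately show "\<omega> \<in> bdry N" by (auto simp: bdry_def)
  qed
  show "bdry N \<subseteq> ?S"
  proof
    fix \<omega> assume \<omega>: "\<omega> \<in> bdry N"
    then have "\<omega> \<in> bitree N" by (simp add: bdry_def)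
    then obtain k a l b where w: "\<omega> = dyadic_interval k a \<times> dyadic_interval l b"
      and u: "\<omega> \<subseteq> {0..1} \<times> {0..1}" and kl: "k \<le> int N" "l \<le> int N"
      unfolding bitree_def powi_scale_le by blast
    define i j where "i = a * 2 ^ nat (int N - k)" and "j = b * 2 ^ nat (int N - l)"
    define \<gamma> where "\<gamma> = dyadic_interval (int N) i \<times> dyadic_interval (int N) j"
    have sub: "\<gamma> \<subseteq> \<omega>"
      unfolding \<gamma>_def w i_def j_def using kl by (intro Sigma_mono dyadic_interval_refine)
    then have un: "\<gamma> \<subseteq> {0..1} \<times> {0..1}" using u by blast
    then have "\<gamma> \<in> bitree N" unfolding bitree_def \<gamma>_def by blast
    then have eq: "\<omega> = \<gamma>" using \<omega> sub by (auto simp: bdry_def)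
    have "dyadic_interval (int N) i \<subseteq> {0..1}" "dyadic_interval (int N) j \<subseteq> {0..1}"
      using un unfolding \<gamma>_def times_subset_iff by (auto simp: dyadic_interval_ne)
    from this[THEN dyadic_interval_subset_unit(2)] this[THEN dyadic_interval_subset_unit(3)]
    show "\<omega> \<in> ?S" unfolding eq \<gamma>_def by auto
  qed
qed

lemma Inf_const_attained:
  fixes F G :: "'x \<Rightarrow> real"
  assumes G: "\<And>x. P x \<Longrightarrow> 0 \<le> G x" and c: "0 \<le> c" "\<forall>x. P x \<longrightarrow> F x \<le> c * G x"
  defines "S \<equiv> {c. 0 \<le> c \<and> (\<forall>x. P x \<longrightarrow> F x \<le> c * G x)}"
  shows "Inf S \<in> S" "\<And>c'. c' \<in> S \<Longrightarrow> Inf S \<le> c'"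
proof -
  have ne: "c \<in> S" using c by (simp add: S_def)
  have bb: "bdd_below S" by (rule bdd_belowI[of _ 0]) (simp add: S_def)
  show "\<And>c'. c' \<in> S \<Longrightarrow> Inf S \<le> c'" using bb by (rule cInf_lower[rotated])
  have "0 \<le> Inf S" using ne by (intro cInf_greatest) (auto simp: S_def)
  moreover have "F x \<le> Inf S * G x" if "P x" for x
  proof (cases "G x = 0")
    case True
    then show ?thesis using c that by fastforce
  next
    case False
    then have g: "G x > 0" using G[OF that] by simp
    have "F x / G x \<le> Inf S"
      using ne g that by (intro cInf_greatest) (auto simp: S_def divide_le_eq)
    then show ?thesis using g by (simp add: divide_le_eq)
  qed
  ultimately show "Inf S \<in> S" by (simp add: S_def)
qed

context
  fixes N :: nat and w \<mu> :: "rectangle \<Rightarrow> real"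
  assumes \<mu>: "bdry_measure N \<mu>" and w: "\<forall>\<alpha> \<in> bitree N. 0 \<le> w \<alpha>"
begin

lemma \<mu>_nonneg: "\<gamma> \<in> bitree N \<Longrightarrow> 0 \<le> \<mu> \<gamma>"
  using \<mu> by (cases "\<gamma> \<in> bdry N") (auto simp: bdry_measure_def)

lemma CE_bound_exists: "CE_bound N w \<mu> (sum w (bitree N) * sum \<mu> (bitree N))"
  unfolding CE_bound_def
proof
  fix \<psi> :: "rectangle \<Rightarrow> real"
  let ?T = "bitree N" and ?Q = "\<Sum>\<omega> \<in> bitree N. \<bar>\<psi> \<omega>\<bar>\<^sup>2 * \<mu> \<omega>"
  have "\<bar>Istar N (\<lambda>\<gamma>. \<psi> \<gamma> * \<mu> \<gamma>) \<alpha>\<bar>\<^sup>2 \<le> sum \<mu> ?T * ?Q" for \<alpha>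
  proof -
    let ?D = "{\<gamma>' \<in> ?T. \<gamma>' \<subseteq> \<alpha>}"
    have "Istar N (\<lambda>\<gamma>. \<psi> \<gamma> * \<mu> \<gamma>) \<alpha> = (\<Sum>\<gamma>\<in>?D. sqrt (\<mu> \<gamma>) * (\<psi> \<gamma> * sqrt (\<mu> \<gamma>)))"
      unfolding Istar_def by (intro sum.cong) (auto simp: \<mu>_nonneg)
    then have "\<bar>Istar N (\<lambda>\<gamma>. \<psi> \<gamma> * \<mu> \<gamma>) \<alpha>\<bar>\<^sup>2
        \<le> (\<Sum>\<gamma>\<in>?D. (sqrt (\<mu> \<gamma>))\<^sup>2) * (\<Sum>\<gamma>\<in>?D. (\<psi> \<gamma> * sqrt (\<mu> \<gamma>))\<^sup>2)"
      using Cauchy_Schwarz_ineq_sum[of "\<lambda>\<gamma>. sqrt (\<mu> \<gamma>)" "\<lambda>\<gamma>. \<psi> \<gamma> * sqrt (\<mu> \<gamma>)" ?D] by simp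
    also have "\<dots> = sum \<mu> ?D * (\<Sum>\<gamma>\<in>?D. \<bar>\<psi> \<gamma>\<bar>\<^sup>2 * \<mu> \<gamma>)"
      by (intro arg_cong2[of _ _ _ _ "(*)"] sum.cong) (auto simp: \<mu>_nonneg power_mult_distrib)
    also have "\<dots> \<le> sum \<mu> ?T * ?Q"
      by (intro mult_mono sum_mono2 sum_nonneg) (auto simp: finite_bitree \<mu>_nonneg)
    finally show ?thesis .
  qed
  then have "(\<Sum>\<alpha> \<in> ?T. w \<alpha> * \<bar>Istar N (\<lambda>\<gamma>. \<psi> \<gamma> * \<mu> \<gamma>) \<alpha>\<bar>\<^sup>2) \<le> (\<Sum>\<alpha> \<in> ?T. w \<alpha> * (sum \<mu> ?T * ?Q))"
    using w by (intro sum_mono mult_left_mono) auto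
  also have "\<dots> = sum w ?T * sum \<mu> ?T * ?Q" by (simp add: sum_distrib_right[symmetric] mult.assoc)
  finally show "(\<Sum>\<alpha> \<in> ?T. w \<alpha> * \<bar>Istar N (\<lambda>\<gamma>. \<psi> \<gamma> * \<mu> \<gamma>) \<alpha>\<bar>\<^sup>2) \<le> sum w ?T * sum \<mu> ?T * ?Q" .
qed

lemma CE_imp_HC:
  assumes "CE_bound N w \<mu> c" shows "HC_bound N w \<mu> c"
  unfolding HC_bound_def
proof (intro allI impI)
  fix E assume E: "E \<subseteq> bitree N"
  have "(\<Sum>\<omega> \<in> bitree N. \<bar>indicator E \<omega> :: real\<bar>\<^sup>2 * \<mu> \<omega>) = (\<Sum>\<omega> \<in> E. \<mu> \<omega>)"
    using E finite_bitree[of N] by (intro sum.mono_neutral_cong_right) auto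
  then show "(\<Sum>\<alpha> \<in> bitree N. w \<alpha> * (Istar N (\<lambda>\<gamma>. \<mu> \<gamma> * indicator E \<gamma>) \<alpha>)\<^sup>2) \<le> c * (\<Sum>\<omega> \<in> E. \<mu> \<omega>)"
    using assms[unfolded CE_bound_def, rule_format, of "indicator E"] by (simp add: mult.commute)
qed

lemma CE_const_least:
  "CE_bound N w \<mu> (CE_const N w \<mu>)"
  "\<And>c. 0 \<le> c \<Longrightarrow> CE_bound N w \<mu> c \<Longrightarrow> CE_const N w \<mu> \<le> c"
proof -
  have c: "0 \<le> sum w (bitree N) * sum \<mu> (bitree N)"
    using w by (intro mult_nonneg_nonneg sum_nonneg) (auto simp: \<mu>_nonneg)
  note * = Inf_const_attained[where P = "\<lambda>_. True", OF _ c, unfolded simp_thms,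
      OF _ CE_bound_exists[unfolded CE_bound_def]]
  have "CE_const N w \<mu> \<in> {c. 0 \<le> c \<and> CE_bound N w \<mu> c}"
    unfolding CE_const_def CE_bound_def by (rule *(1)) (auto intro!: sum_nonneg simp: \<mu>_nonneg)
  then show "CE_bound N w \<mu> (CE_const N w \<mu>)" by simp
  show "CE_const N w \<mu> \<le> c" if "0 \<le> c" "CE_bound N w \<mu> c" for c
    unfolding CE_const_def using that by (intro cInf_lower bdd_belowI[of _ 0]) auto
qed

lemma HC_const_least:
  "HC_bound N w \<mu> (HC_const N w \<mu>)"
  "\<And>c. 0 \<le> c \<Longrightarrow> HC_bound N w \<mu> c \<Longrightarrow> HC_const N w \<mu> \<le> c"
proof -
  have c: "0 \<le> sum w (bitree N) * sum \<mu> (bitree N)"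
    using w by (intro mult_nonneg_nonneg sum_nonneg) (auto simp: \<mu>_nonneg)
  note * = Inf_const_attained[where P = "\<lambda>E. E \<subseteq> bitree N", OF _ c,
      OF _ CE_imp_HC[OF CE_bound_exists, unfolded HC_bound_def]]
  have "HC_const N w \<mu> \<in> {c. 0 \<le> c \<and> HC_bound N w \<mu> c}"
    unfolding HC_const_def HC_bound_def by (rule *(1)) (auto intro!: sum_nonneg simp: \<mu>_nonneg)
  then show "HC_bound N w \<mu> (HC_const N w \<mu>)" by simp
  show "HC_const N w \<mu> \<le> c" if "0 \<le> c" "HC_bound N w \<mu> c" for c
    unfolding HC_const_def using that by (intro cInf_lower bdd_belowI[of _ 0]) auto
qed

end

end

theory Submission
  imports Defs
begin

text \<open>
  Let \<open>n = 2 ^ M\<close> and \<open>N = n\<close>. The rectangles \<open>[0, 2\<^sup>-\<^sup>i) \<times> [0, 2\<^sup>-\<^sup>(\<^sup>n\<^sup>-\<^sup>1\<^sup>-\<^sup>i\<^sup>))\<close>, \<open>i < n\<close>,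
  form an antichain, and for any \<open>c < d \<le> n\<close> some minimal square lies in exactly those with
  \<open>i \<in> J = [c, d)\<close>. Let \<open>w\<close> be the indicator of these rectangles, and let \<open>\<mu>\<close> put mass \<open>1 / |J|\<close>
  on the square belonging to each dyadic interval \<open>J\<close> of \<open>[0, n)\<close>. The masses seen by a fixed
  \<open>i\<close> are distinct powers of \<open>1/2\<close>, so the square of the sum of any subfamily is at most four
  times the sum of the squares; summing over \<open>i\<close> gives the restricted condition with constant
  \<open>4\<close>. For \<open>\<psi>(J) = |J|\<close> every \<open>i\<close> sees the sum \<open>M + 1\<close>, while \<open>\<psi>\<close> has squared norm \<open>(M + 1) n\<close>,
  so the embedding constant is at least \<open>M + 1\<close>.
\<close>

section \<open>Corner rectangles and the minimal squares below them\<close>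

text \<open>In units of the mesh \<open>2 powi (- int n)\<close> both intervals have integer
  endpoints, so containment is decided by the left endpoint alone.\<close>

lemma dyadic_interval_subset_corner_iff:
  assumes "0 \<le> j" "k \<le> n"
  shows "dyadic_interval (int n) j \<subseteq> dyadic_interval (int k) 0 \<longleftrightarrow> j < 2 ^ (n - k)"
proof -
  define e :: real where "e = 2 powi (- int n)"
  have e: "e > 0" by (simp add: e_def)
  have "2 powi (- int k) = (2::real) powi (int n - int k) * 2 powi (- int n)"
    by (subst power_int_add[symmetric]) auto
  then have d: "2 powi (- int k) = 2 ^ (n - k) * e"
    using assms(2) by (simp add: e_def power_int_def flip: of_nat_diff)
  have J: "dyadic_interval (int n) j = {of_int j * e ..< (of_int j + 1) * e}"
    and K: "dyadic_interval (int k) 0 = {0 ..< 2 ^ (n - k) * e}"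
    by (simp_all add: dyadic_interval_def d flip: e_def)
  have "of_int j * e \<in> dyadic_interval (int n) j" using e by (simp add: J)
  moreover have "j < 2 ^ (n - k)" if "of_int j * e \<in> dyadic_interval (int k) 0"
  proof -
    have "of_int j < (2::real) ^ (n - k)" using that e by (simp add: K)
    then have "of_int j < (of_int (2 ^ (n - k)) :: real)" by simp
    then show ?thesis by (simp only: of_int_less_iff)
  qed
  moreover have "dyadic_interval (int n) j \<subseteq> dyadic_interval (int k) 0" if "j < 2 ^ (n - k)"
  proof -
    have "of_int (j + 1) \<le> (of_int (2 ^ (n - k)) :: real)"
      using that by (simp only: of_int_le_iff)
    then have "(of_int j + 1) * e \<le> 2 ^ (n - k) * e" using e by simp
    moreover have "0 \<le> of_int j * e" using assms(1) e by simp
    ultimately show ?thesis unfolding J K by auto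
  qed
  ultimately show ?thesis by blast
qed

definition corner_rect :: "nat \<Rightarrow> nat \<Rightarrow> rectangle" where
  "corner_rect n i = dyadic_interval (int i) 0 \<times> dyadic_interval (int (n - 1 - i)) 0"

text \<open>The two grid positions are powers of two so that each coordinate tests one end of the
  index interval: \<open>2 ^ (n - d) < 2 ^ (n - i)\<close> says \<open>i < d\<close>, and
  \<open>2 ^ c < 2 ^ Suc i\<close> says \<open>c \<le> i\<close>.\<close>

definition interval_cell :: "nat \<Rightarrow> nat \<Rightarrow> nat \<Rightarrow> rectangle" where
  "interval_cell n c d = dyadic_interval (int n) (2 ^ (n - d)) \<times> dyadic_interval (int n) (2 ^ c)"

lemma interval_cell_subset_iff:
  assumes "c < d" "d \<le> n" "i < n"
  shows "interval_cell n c d \<subseteq> corner_rect n i \<longleftrightarrow> i \<in> {c..<d}"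
proof -
  have "dyadic_interval (int n) (2 ^ (n - d)) \<subseteq> dyadic_interval (int i) 0 \<longleftrightarrow> i < d"
    using assms by (subst dyadic_interval_subset_corner_iff) auto
  moreover have "dyadic_interval (int n) (2 ^ c) \<subseteq> dyadic_interval (int (n - 1 - i)) 0 \<longleftrightarrow> c \<le> i"
  proof -
    \<comment> \<open>The side exponents of \<open>corner_rect\<close> add up to
      \<open>n - 1\<close>, not \<open>n\<close>; this successor turns the strict comparison of
      powers into \<open>c \<le> i\<close>.\<close>
    have "n - (n - 1 - i) = Suc i" using assms by simp
    then show ?thesis
      by (subst dyadic_interval_subset_corner_iff) (simp_all add: less_Suc_eq_le del: power_Suc)
  qed
  ultimately show ?thesis
    unfolding interval_cell_def corner_rect_def times_subset_iff by (auto simp: dyadic_interval_ne)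
qed

lemma dyadic_interval_eq_iff:
  "dyadic_interval k i = dyadic_interval k j \<longleftrightarrow> i = j"
proof
  have lt: "of_int i * 2 powi - k < (of_int i + 1) * (2::real) powi - k" for i
    by (intro mult_strict_right_mono) auto
  assume "dyadic_interval k i = dyadic_interval k j"
  then have "of_int i * (2::real) powi - k = of_int j * 2 powi - k"
    unfolding dyadic_interval_def by (subst (asm) Ico_eq_Ico) (use lt[of i] in auto)
  then show "i = j" by simp
qed simp

lemma interval_cell_eq_iff:
  assumes "d \<le> n" "d' \<le> n"
  shows "interval_cell n c d = interval_cell n c' d' \<longleftrightarrow> c = c' \<and> d = d'"
  using assms
  by (auto simp: interval_cell_def times_eq_iff dyadic_interval_ne dyadic_interval_eq_iff)

lemma interval_cell_in_bdry:
  assumes "c < d" "d \<le> n"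
  shows "interval_cell n c d \<in> bdry n"
  unfolding bdry_eq interval_cell_def using assms by (intro CollectI exI conjI refl) auto

lemma corner_rect_in_bitree:
  assumes "i < n"
  shows "corner_rect n i \<in> bitree n"
proof -
  have unit: "dyadic_interval (int k) 0 \<subseteq> {0..1}" for k
    using dyadic_interval_unit[of 0 k] by simp
  show ?thesis
    unfolding bitree_def corner_rect_def powi_scale_le
    by (intro CollectI exI conjI, rule refl, intro Sigma_mono unit) (use assms in simp_all)
qed

text \<open>The cell of the singleton interval \<open>{i..<Suc i}\<close> lies below no corner
  rectangle but the one of index \<open>i\<close>, so it tells them apart.\<close>

lemma inj_on_corner_rect: "inj_on (corner_rect n) {..<n}"
proof (rule inj_onI)
  fix i j assume *: "i \<in> {..<n}" "j \<in> {..<n}" "corner_rect n i = corner_rect n j"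
  have "interval_cell n i (Suc i) \<subseteq> corner_rect n i"
    using *(1) by (subst interval_cell_subset_iff) auto
  then have "interval_cell n i (Suc i) \<subseteq> corner_rect n j" unfolding *(3) .
  then have "j \<in> {i..<Suc i}"
    using *(1,2) by (subst (asm) interval_cell_subset_iff) auto
  then show "i = j" by auto
qed

section \<open>Lacunary sums and sums over dyadic blocks\<close>

text \<open>Split off the term \<open>k = 0\<close>. If it vanishes, shifting the index scales both
  sides by \<open>1/4\<close>. If it is \<open>1\<close>, the geometric series bounds the left side
  by \<open>4\<close>, and the right side is at least \<open>4\<close>.\<close>

lemma lacunary_sum_square_le:
  fixes e :: "nat \<Rightarrow> real"
  assumes "\<And>k. e k \<in> {0, 1}"
  shows "(\<Sum>k\<le>M. e k / 2 ^ k)\<^sup>2 \<le> 4 * (\<Sum>k\<le>M. e k / 4 ^ k)"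
  using assms
proof (induction M arbitrary: e)
  case 0
  show ?case using "0.prems"[of 0] by auto
next
  case (Suc M)
  have nonneg: "0 \<le> e k" and le1: "e k \<le> 1" for k using Suc.prems[of k] by auto
  have S: "(\<Sum>k\<le>Suc M. e k / 2 ^ k) = e 0 + (\<Sum>k\<le>M. e (Suc k) / 2 ^ k) / 2"
    by (simp add: sum.atMost_Suc_shift sum_divide_distrib field_simps del: sum.atMost_Suc)
  have Q: "(\<Sum>k\<le>Suc M. e k / 4 ^ k) = e 0 + (\<Sum>k\<le>M. e (Suc k) / 4 ^ k) / 4"
    by (simp add: sum.atMost_Suc_shift sum_divide_distrib field_simps del: sum.atMost_Suc)
  have IH: "(\<Sum>k\<le>M. e (Suc k) / 2 ^ k)\<^sup>2 \<le> 4 * (\<Sum>k\<le>M. e (Suc k) / 4 ^ k)"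
    using Suc.prems by (intro Suc.IH)
  show ?case
  proof (cases "e 0 = 0")
    case True
    then show ?thesis using IH unfolding S Q by (simp add: power_divide)
  next
    case False
    then have e0: "e 0 = 1" using Suc.prems[of 0] by auto
    have "(\<Sum>k\<le>M. e (Suc k) / 2 ^ k) \<le> (\<Sum>k\<le>M. (1/2) ^ k)"
      using le1 by (intro sum_mono) (simp add: power_divide divide_right_mono)
    also have "\<dots> \<le> 2" by (simp add: sum_gp0)
    finally have "e 0 + (\<Sum>k\<le>M. e (Suc k) / 2 ^ k) / 2 \<le> 2" using e0 by simp
    moreover have "0 \<le> e 0 + (\<Sum>k\<le>M. e (Suc k) / 2 ^ k) / 2"
      using nonneg by (intro add_nonneg_nonneg divide_nonneg_nonneg sum_nonneg) auto
    ultimately have "(e 0 + (\<Sum>k\<le>M. e (Suc k) / 2 ^ k) / 2)\<^sup>2 \<le> 2\<^sup>2" by (rule power_mono)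
    moreover have "0 \<le> (\<Sum>k\<le>M. e (Suc k) / 4 ^ k)" using nonneg by (intro sum_nonneg) auto
    ultimately show ?thesis unfolding S Q using e0 by simp
  qed
qed

text \<open>The quotient is constant on consecutive blocks of length \<open>2 ^ k\<close>. The
  factor \<open>2 ^ k\<close> will count the corner rectangles above a cell of level
  \<open>k\<close>.\<close>

lemma sum_div_pow2:
  fixes f :: "nat \<Rightarrow> real"
  assumes "k \<le> M"
  shows "(\<Sum>i<2 ^ M. f (i div 2 ^ k)) = 2 ^ k * (\<Sum>m<2 ^ (M - k). f m)"
proof -
  have "(\<Sum>i<2 ^ M. f (i div 2 ^ k)) = (\<Sum>i<2 ^ (M - k) * 2 ^ k. f (i div 2 ^ k))"
    using assms by (simp flip: power_add)
  also have "\<dots> = (\<Sum>m<2 ^ (M - k). \<Sum>i = m * 2 ^ k..<m * 2 ^ k + 2 ^ k. f (i div 2 ^ k))"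
    by (rule sum.nat_group[symmetric])
  also have "\<dots> = (\<Sum>m<2 ^ (M - k). \<Sum>i = m * 2 ^ k..<m * 2 ^ k + 2 ^ k. f m)"
    by (intro sum.cong refl arg_cong[of _ _ f]) (auto intro!: div_nat_eqI simp: algebra_simps)
  also have "\<dots> = 2 ^ k * (\<Sum>m<2 ^ (M - k). f m)" by (simp add: sum_distrib_left)
  finally show ?thesis .
qed

section \<open>The measure on dyadic cells and the weight on corner rectangles\<close>

text \<open>The pair \<open>(k, m)\<close> stands for the dyadic interval
  \<open>{m * 2 ^ k..<Suc m * 2 ^ k}\<close> of indices below \<open>2 ^ M\<close>.\<close>

definition dyadic_indices :: "nat \<Rightarrow> (nat \<times> nat) set" where
  "dyadic_indices M = (SIGMA k:{..M}. {..<2 ^ (M - k)})"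

definition dyadic_cell :: "nat \<Rightarrow> nat \<times> nat \<Rightarrow> rectangle" where
  "dyadic_cell M = (\<lambda>(k, m). interval_cell (2 ^ M) (m * 2 ^ k) (Suc m * 2 ^ k))"

text \<open>Measure and test function must take rectangles as arguments, so the level is read back
  from the cell; the value is meaningful only on the image of \<open>dyadic_cell\<close>.\<close>

definition cell_level :: "nat \<Rightarrow> rectangle \<Rightarrow> nat" where
  "cell_level M \<gamma> = fst (inv_into (dyadic_indices M) (dyadic_cell M) \<gamma>)"

definition cell_measure :: "nat \<Rightarrow> rectangle \<Rightarrow> real" where
  "cell_measure M \<gamma> = (if \<gamma> \<in> dyadic_cell M ` dyadic_indices M then 1 / 2 ^ cell_level M \<gamma> else 0)"

definition corner_weight :: "nat \<Rightarrow> rectangle \<Rightarrow> real" where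
  "corner_weight n = indicator (corner_rect n ` {..<n})"

lemma dyadic_indices_bounds:
  assumes "(k, m) \<in> dyadic_indices M"
  shows "m * 2 ^ k < Suc m * 2 ^ k" "Suc m * 2 ^ k \<le> 2 ^ M"
proof -
  have "Suc m * 2 ^ k \<le> 2 ^ (M - k) * 2 ^ k"
    using assms by (intro mult_right_mono) (auto simp: dyadic_indices_def)
  also have "\<dots> = 2 ^ M" using assms by (simp add: dyadic_indices_def flip: power_add)
  finally show "Suc m * 2 ^ k \<le> 2 ^ M" .
qed simp

lemma inj_on_dyadic_cell: "inj_on (dyadic_cell M) (dyadic_indices M)"
proof (rule inj_onI, clarify)
  fix k m k' m'
  assume *: "(k, m) \<in> dyadic_indices M" "(k', m') \<in> dyadic_indices M"
    and "dyadic_cell M (k, m) = dyadic_cell M (k', m')"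
  then have eq: "m * 2 ^ k = m' * 2 ^ k'" "Suc m * 2 ^ k = Suc m' * 2 ^ k'"
    unfolding dyadic_cell_def prod.case
    using interval_cell_eq_iff[OF *[THEN dyadic_indices_bounds(2)]] by blast+
  \<comment> \<open>Subtracting the equations for the endpoints leaves the lengths.\<close>
  then have "(2::nat) ^ k = 2 ^ k'" by simp
  with eq show "k = k' \<and> m = m'" by simp
qed

lemma dyadic_cell_in_bdry: "p \<in> dyadic_indices M \<Longrightarrow> dyadic_cell M p \<in> bdry (2 ^ M)"
  by (cases p) (auto simp del: mult_Suc simp: dyadic_cell_def
      intro!: interval_cell_in_bdry dyadic_indices_bounds)

text \<open>Each \<open>i\<close> lies in exactly one dyadic interval of length
  \<open>2 ^ k\<close>, so a sum over the cells below a corner rectangle collapses to one term per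
  level.\<close>

lemma dyadic_cell_subset_iff:
  assumes "(k, m) \<in> dyadic_indices M" "i < 2 ^ M"
  shows "dyadic_cell M (k, m) \<subseteq> corner_rect (2 ^ M) i \<longleftrightarrow> m = i div 2 ^ k"
proof -
  have "dyadic_cell M (k, m) \<subseteq> corner_rect (2 ^ M) i \<longleftrightarrow> i \<in> {m * 2 ^ k..<Suc m * 2 ^ k}"
    unfolding dyadic_cell_def prod.case
    by (intro interval_cell_subset_iff dyadic_indices_bounds[OF assms(1)] assms(2))
  also have "\<dots> \<longleftrightarrow> m = i div 2 ^ k"
    using div_nat_eqI[of "2 ^ k" m i] div_times_less_eq_dividend[of i "2 ^ k"]
      dividend_less_div_times[of "2 ^ k" i]
    by (auto simp: mult.commute)
  finally show ?thesis .
qed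

lemma cell_measure_dyadic_cell:
  assumes "(k, m) \<in> dyadic_indices M"
  shows "cell_measure M (dyadic_cell M (k, m)) = 1 / 2 ^ k" "cell_level M (dyadic_cell M (k, m)) = k"
  using assms by (auto simp: cell_measure_def cell_level_def inv_into_f_f[OF inj_on_dyadic_cell])

lemma cell_measure_bdry_measure: "bdry_measure (2 ^ M) (cell_measure M)"
  using dyadic_cell_in_bdry by (auto simp: bdry_measure_def cell_measure_def)

lemma sum_cell_measure:
  "(\<Sum>\<gamma>\<in>bitree (2 ^ M). f \<gamma> * cell_measure M \<gamma>) =
    (\<Sum>k\<le>M. \<Sum>m<2 ^ (M - k). f (dyadic_cell M (k, m)) / 2 ^ k)"
proof -
  have "dyadic_cell M ` dyadic_indices M \<subseteq> bitree (2 ^ M)"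
    using dyadic_cell_in_bdry by (auto simp: bdry_def)
  then have "(\<Sum>\<gamma>\<in>bitree (2 ^ M). f \<gamma> * cell_measure M \<gamma>) =
      (\<Sum>\<gamma>\<in>dyadic_cell M ` dyadic_indices M. f \<gamma> * cell_measure M \<gamma>)"
    by (intro sum.mono_neutral_right finite_bitree) (auto simp: cell_measure_def)
  also have "\<dots> = (\<Sum>p\<in>dyadic_indices M. f (dyadic_cell M p) * cell_measure M (dyadic_cell M p))"
    by (simp add: sum.reindex[OF inj_on_dyadic_cell])
  also have "\<dots> = (\<Sum>(k, m)\<in>dyadic_indices M. f (dyadic_cell M (k, m)) / 2 ^ k)"
    by (intro sum.cong refl) (auto simp: cell_measure_dyadic_cell)
  finally show ?thesis by (simp add: dyadic_indices_def sum.Sigma)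
qed

lemma Istar_cell_measure:
  assumes i: "i < 2 ^ M"
  shows "Istar (2 ^ M) (\<lambda>\<gamma>. f \<gamma> * cell_measure M \<gamma>) (corner_rect (2 ^ M) i) =
    (\<Sum>k\<le>M. f (dyadic_cell M (k, i div 2 ^ k)) / 2 ^ k)"
proof -
  let ?R = "corner_rect (2 ^ M) i"
  have "Istar (2 ^ M) (\<lambda>\<gamma>. f \<gamma> * cell_measure M \<gamma>) ?R =
      (\<Sum>\<gamma>\<in>bitree (2 ^ M). (if \<gamma> \<subseteq> ?R then f \<gamma> else 0) * cell_measure M \<gamma>)"
    unfolding Istar_def by (intro sum.mono_neutral_cong_left finite_bitree) auto
  also have "\<dots> = (\<Sum>k\<le>M. \<Sum>m<2 ^ (M - k).
      (if dyadic_cell M (k, m) \<subseteq> ?R then f (dyadic_cell M (k, m)) else 0) / 2 ^ k)"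
    by (rule sum_cell_measure)
  also have "\<dots> = (\<Sum>k\<le>M. f (dyadic_cell M (k, i div 2 ^ k)) / 2 ^ k)"
  proof (rule sum.cong[OF refl])
    fix k assume "k \<in> {..M}"
    then have k: "k \<le> M" by simp
    have "i < 2 ^ (M - k) * 2 ^ k" using i k by (simp flip: power_add)
    \<comment> \<open>The quotient is in the range of \<open>m\<close>, so the sum over
      \<open>m\<close> picks up its one term.\<close>
    then have "i div 2 ^ k < 2 ^ (M - k)" by (rule less_mult_imp_div_less)
    moreover have "(\<Sum>m<2 ^ (M - k).
        (if dyadic_cell M (k, m) \<subseteq> ?R then f (dyadic_cell M (k, m)) else 0) / 2 ^ k) =
        (\<Sum>m<2 ^ (M - k). if m = i div 2 ^ k then f (dyadic_cell M (k, m)) / 2 ^ k else 0)"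
      using k i by (intro sum.cong refl) (auto simp: dyadic_cell_subset_iff dyadic_indices_def)
    ultimately show "(\<Sum>m<2 ^ (M - k).
        (if dyadic_cell M (k, m) \<subseteq> ?R then f (dyadic_cell M (k, m)) else 0) / 2 ^ k) =
        f (dyadic_cell M (k, i div 2 ^ k)) / 2 ^ k"
      by simp
  qed
  finally show ?thesis .
qed

lemma sum_corner_weight:
  "(\<Sum>\<alpha>\<in>bitree n. corner_weight n \<alpha> * F \<alpha>) = (\<Sum>i<n. F (corner_rect n i))"
proof -
  have "(\<Sum>\<alpha>\<in>bitree n. corner_weight n \<alpha> * F \<alpha>) = (\<Sum>\<alpha>\<in>corner_rect n ` {..<n}. F \<alpha>)"
    by (intro sum.mono_neutral_cong_right finite_bitree)
      (auto simp: corner_weight_def corner_rect_in_bitree)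
  then show ?thesis by (simp add: sum.reindex[OF inj_on_corner_rect])
qed

section \<open>Bounds for the two constants\<close>

text \<open>After the lacunary estimate for each \<open>i\<close>, a cell of \<open>E\<close> at
  level \<open>k\<close> contributes \<open>1 / 4 ^ k\<close> at each of the \<open>2 ^ k\<close>
  corner rectangles above it, in total \<open>1 / 2 ^ k\<close>, which is its mass.\<close>

lemma HC_bound_cell_measure: "HC_bound (2 ^ M) (corner_weight (2 ^ M)) (cell_measure M) 4"
  unfolding HC_bound_def
proof (intro allI impI)
  fix E assume E: "E \<subseteq> bitree (2 ^ M)"
  define e :: "nat \<Rightarrow> nat \<Rightarrow> real" where "e k m = indicator E (dyadic_cell M (k, m))" for k m
  have "(\<Sum>\<alpha>\<in>bitree (2 ^ M). corner_weight (2 ^ M) \<alpha> *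
        (Istar (2 ^ M) (\<lambda>\<gamma>. cell_measure M \<gamma> * indicator E \<gamma>) \<alpha>)\<^sup>2) =
      (\<Sum>i<2 ^ M. (\<Sum>k\<le>M. e k (i div 2 ^ k) / 2 ^ k)\<^sup>2)"
    unfolding sum_corner_weight mult.commute[of "cell_measure M _"]
    by (intro sum.cong refl) (simp add: Istar_cell_measure e_def)
  also have "\<dots> \<le> (\<Sum>i<2 ^ M. 4 * (\<Sum>k\<le>M. e k (i div 2 ^ k) / 4 ^ k))"
    by (intro sum_mono lacunary_sum_square_le) (simp add: e_def indicator_def)
  also have "\<dots> = 4 * (\<Sum>k\<le>M. \<Sum>i<2 ^ M. e k (i div 2 ^ k) / 4 ^ k)"
    by (subst sum.swap) (simp add: sum_distrib_left)
  also have "\<dots> = 4 * (\<Sum>k\<le>M. \<Sum>m<2 ^ (M - k). e k m / 2 ^ k)"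
  proof (rule arg_cong[of _ _ "(*) 4"], rule sum.cong[OF refl])
    fix k assume "k \<in> {..M}"
    then have "(\<Sum>i<2 ^ M. e k (i div 2 ^ k) / 4 ^ k) = 2 ^ k * (\<Sum>m<2 ^ (M - k). e k m / 4 ^ k)"
      using sum_div_pow2[of k M "\<lambda>m. e k m / 4 ^ k"] by simp
    moreover have "(4::real) ^ k = 2 ^ k * 2 ^ k" by (simp flip: power_mult_distrib)
    ultimately show "(\<Sum>i<2 ^ M. e k (i div 2 ^ k) / 4 ^ k) = (\<Sum>m<2 ^ (M - k). e k m / 2 ^ k)"
      by (simp add: sum_distrib_left)
  qed
  also have "\<dots> = 4 * (\<Sum>\<gamma>\<in>bitree (2 ^ M). indicator E \<gamma> * cell_measure M \<gamma>)"
    by (simp add: sum_cell_measure e_def)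
  also have "(\<Sum>\<gamma>\<in>bitree (2 ^ M). indicator E \<gamma> * cell_measure M \<gamma>) = (\<Sum>\<omega>\<in>E. cell_measure M \<omega>)"
    using E by (intro sum.mono_neutral_cong_right finite_bitree) auto
  finally show "(\<Sum>\<alpha>\<in>bitree (2 ^ M). corner_weight (2 ^ M) \<alpha> *
      (Istar (2 ^ M) (\<lambda>\<gamma>. cell_measure M \<gamma> * indicator E \<gamma>) \<alpha>)\<^sup>2) \<le> 4 * (\<Sum>\<omega>\<in>E. cell_measure M \<omega>)" .
qed

text \<open>The test function cancels the mass of every cell, so no decay over the levels remains:
  testing gives \<open>(M + 1)^2 * 2 ^ M\<close> on the left against
  \<open>c * (M + 1) * 2 ^ M\<close> on the right.\<close>

lemma CE_bound_cell_measure: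
  assumes "CE_bound (2 ^ M) (corner_weight (2 ^ M)) (cell_measure M) c"
  shows "real (Suc M) \<le> c"
proof -
  define \<psi> :: "rectangle \<Rightarrow> real" where "\<psi> \<gamma> = 2 ^ cell_level M \<gamma>" for \<gamma>
  have \<psi>: "\<psi> (dyadic_cell M (k, m)) = 2 ^ k" if "k \<le> M" "m < 2 ^ (M - k)" for k m
    using that by (simp add: \<psi>_def cell_measure_dyadic_cell dyadic_indices_def)
  have "(\<Sum>\<omega>\<in>bitree (2 ^ M). \<bar>\<psi> \<omega>\<bar>\<^sup>2 * cell_measure M \<omega>) = (\<Sum>k\<le>M. \<Sum>m<(2::nat) ^ (M - k). 2 ^ k)"
    unfolding sum_cell_measure
    by (intro sum.cong refl) (simp add: \<psi> power2_eq_square)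
  \<comment> \<open>Level \<open>k\<close> has \<open>2 ^ (M - k)\<close> cells, each contributing
    \<open>4 ^ k / 2 ^ k\<close>, so all levels weigh the same.\<close>
  also have "\<dots> = (\<Sum>k\<le>M. 2 ^ M)" by (intro sum.cong refl) (simp flip: power_add)
  finally have R: "(\<Sum>\<omega>\<in>bitree (2 ^ M). \<bar>\<psi> \<omega>\<bar>\<^sup>2 * cell_measure M \<omega>) = real (Suc M) * 2 ^ M"
    by simp
  have I: "Istar (2 ^ M) (\<lambda>\<gamma>. \<psi> \<gamma> * cell_measure M \<gamma>) (corner_rect (2 ^ M) i) = real (Suc M)"
    if i: "i < 2 ^ M" for i
  proof -
    have "(\<Sum>k\<le>M. \<psi> (dyadic_cell M (k, i div 2 ^ k)) / 2 ^ k) = (\<Sum>k\<le>M. 1)"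
    proof (rule sum.cong[OF refl])
      fix k assume "k \<in> {..M}"
      then have k: "k \<le> M" by simp
      then have "i < 2 ^ (M - k) * 2 ^ k" using i by (simp flip: power_add)
      then show "\<psi> (dyadic_cell M (k, i div 2 ^ k)) / 2 ^ k = 1"
        using k by (simp add: \<psi> less_mult_imp_div_less)
    qed
    then show ?thesis by (simp add: Istar_cell_measure i)
  qed
  have "(\<Sum>\<alpha>\<in>bitree (2 ^ M). corner_weight (2 ^ M) \<alpha> *
      \<bar>Istar (2 ^ M) (\<lambda>\<gamma>. \<psi> \<gamma> * cell_measure M \<gamma>) \<alpha>\<bar>\<^sup>2) \<le> c * (real (Suc M) * 2 ^ M)"
    using assms unfolding CE_bound_def R[symmetric] by blast
  then have "real (Suc M) * (real (Suc M) * 2 ^ M) \<le> c * (real (Suc M) * 2 ^ M)"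
    by (simp add: sum_corner_weight I power2_eq_square mult_ac del: of_nat_Suc)
  then show ?thesis by (rule mult_right_le_imp_le) simp
qed

theorem mainTheorem3:
  shows "\<exists>C > 0. \<forall>A > 0. \<exists>(N :: nat) (w :: rectangle \<Rightarrow> real) (\<mu> :: rectangle \<Rightarrow> real).
    (\<forall>\<alpha> \<in> bitree N. w \<alpha> \<in> {0, 1}) \<and> bdry_measure N \<mu> \<and>
    HC_const N w \<mu> \<le> C \<and> A \<le> CE_const N w \<mu>"
proof (rule exI[of _ 4], intro conjI allI impI)
  fix A :: real assume "A > 0"
  obtain M where M: "A \<le> real M" using real_arch_simple by blast
  have w: "\<forall>\<alpha>\<in>bitree (2 ^ M). 0 \<le> corner_weight (2 ^ M) \<alpha>" by (simp add: corner_weight_def)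
  note \<mu> = cell_measure_bdry_measure[of M]
  have "HC_const (2 ^ M) (corner_weight (2 ^ M)) (cell_measure M) \<le> 4"
    by (rule HC_const_least(2)[OF \<mu> w _ HC_bound_cell_measure]) simp
  \<comment> \<open>The infimum is attained, so \<open>CE_const\<close> is itself an admissible
    constant and hence at least \<open>M + 1\<close>.\<close>
  moreover have "A \<le> CE_const (2 ^ M) (corner_weight (2 ^ M)) (cell_measure M)"
    using M CE_bound_cell_measure[OF CE_const_least(1)[OF \<mu> w]] by simp
  ultimately show "\<exists>N w \<mu>. (\<forall>\<alpha> \<in> bitree N. w \<alpha> \<in> {0, 1}) \<and> bdry_measure N \<mu> \<and>
      HC_const N w \<mu> \<le> 4 \<and> A \<le> CE_const N w \<mu>"
    using \<mu> by (intro exI[of _ "2 ^ M"] exI[of _ "corner_weight (2 ^ M)"] exI[of _ "cell_measure M"])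
      (auto simp: corner_weight_def indicator_def)
qed simp

end
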